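(* Let $M\subseteq\mathbb{R}^d$ be a free $\mathbb{Z}$-module spanning $\mathbb{R}^d$, let $R,S\in\mathrm{OS}(M)$ and let $\alpha$ be any element of $\mathrm{scal}_M(R)$. Then \[ \mathrm{scal}_M(R)=\alpha\,\mathrm{scal}_M(E),\qquad \mathrm{scal}_M(RS)=\mathrm{scal}_M(R)\,\mathrm{scal}_M(S), \] where $E$ is the identity and the product of sets is $\{ab\mid a\in\mathrm{scal}_M(R),\,b\in\mathrm{scal}_M(S)\}$.
   Context: A free $\mathbb{Z}$-module in $\mathbb{R}^d$ is $M=\langle t_1,\dots,t_k\rangle_{\mathbb{Z}}$ with $t_1,\dots,t_k\in\mathbb{R}^d$ rationally independent and spanning $\mathbb{R}^d$. Two modules $M_1,M_2\subseteq\mathbb{R}^d$ are commensurate, $M_1\sim M_2$, if $M_1\cap M_2$ has finite index in both. $\mathrm{OS}(M)=\{R\in\mathrm{O}(d,\mathbb{R})\mid\exists\,\alpha\in\mathbb{R}^+,\ \alpha RM\subseteq M\}$. For $R\in\mathrm{O}(d,\mathbb{R})$, $\mathrm{scal}_M(R):=\{\alpha\in\mathbb{R}\mid\alpha RM\sim M\}$. *)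

theory Defs
  imports "HOL-Analysis.Analysis"
begin

global_interpretation int_module:
  module "\<lambda>(n::int) (v::'a::real_vector). real_of_int n *\<^sub>R v"
  defines int_span = int_module.span
  by standard (simp_all add: scaleR_right_distrib scaleR_left_distrib)

global_interpretation rat_space:
  vector_space "\<lambda>(q::rat) (v::'a::real_vector). (of_rat q :: real) *\<^sub>R v"
  defines rat_dependent = rat_space.dependent
  by standard (simp_all add: scaleR_right_distrib scaleR_left_distrib of_rat_add of_rat_mult)

definition spanning_free_module :: "(real ^ 'd) set \<Rightarrow> bool" where
  "spanning_free_module M \<longleftrightarrow>
     (\<exists>B. finite B \<and> \<not> rat_dependent B \<and> span B = UNIV \<and> M = int_span B)"

definition finite_index_in :: "('a::ab_group_add) set \<Rightarrow> 'a set \<Rightarrow> bool" where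
  "finite_index_in N M \<longleftrightarrow> finite ((\<lambda>x. (+) x ` N) ` M)"

definition commensurate :: "('a::ab_group_add) set \<Rightarrow> 'a set \<Rightarrow> bool" where
  "commensurate M N \<longleftrightarrow> finite_index_in (M \<inter> N) M \<and> finite_index_in (M \<inter> N) N"

definition scaled_image :: "real \<Rightarrow> real ^ 'd ^ 'd \<Rightarrow> (real ^ 'd) set \<Rightarrow> (real ^ 'd) set" where
  "scaled_image \<alpha> R M = (\<lambda>x. \<alpha> *\<^sub>R (R *v x)) ` M"

definition OS :: "(real ^ 'd) set \<Rightarrow> (real ^ 'd ^ 'd) set" where
  "OS M = {R. orthogonal_matrix R \<and> (\<exists>\<alpha>>0. scaled_image \<alpha> R M \<subseteq> M)}"

text \<open>All real \<open>\<alpha>\<close> are admitted. For \<open>\<alpha> = 0\<close> the image is \<open>{0}\<close>, which has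
  infinite index in a spanning free module, so \<open>0\<close> never belongs to this set.\<close>

definition scal :: "(real ^ 'd) set \<Rightarrow> real ^ 'd ^ 'd \<Rightarrow> real set" where
  "scal M R = {\<alpha>. commensurate (scaled_image \<alpha> R M) M}"

end

theory Submission imports Defs begin

text \<open>Commensurability is an equivalence relation on subgroups and is preserved by every additive
  map. Hence the scaled images can be transported along \<open>\<alpha>R\<close>, and what remains is that
  \<open>scal M S\<close> is nonempty for \<open>S \<in> OS M\<close>: a linear injection \<open>f\<close> mapping \<open>M = int_span B\<close> into
  itself is bijective on the rational span of \<open>B\<close>, so clearing denominators gives \<open>N > 0\<close> with
  \<open>N M \<subseteq> f M\<close>, and \<open>N M\<close> has finite index in the finitely generated group \<open>M\<close>.\<close>

section \<open>Finite index and commensurability\<close>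

text \<open>For a real vector space, the submodules over the integers are the additive subgroups.\<close>

lemma finite_index_inE:
  fixes H :: "'a::real_vector set"
  assumes H: "int_module.subspace H" and HM: "finite_index_in H M"
  obtains F where "finite F" "\<forall>x\<in>M. \<exists>y\<in>F. x - y \<in> H"
proof -
  define c where "c x = (+) x ` H" for x
  have "finite (c ` M)"
    using HM by (simp add: finite_index_in_def c_def)
  \<comment> \<open>Only finitely many cosets occur, so a finite \<open>F\<close> containing one
    point of each suffices.\<close>
  then obtain F where F: "F \<subseteq> M" "finite F" "c ` M = c ` F"
    using finite_subset_image[of "c ` M" c M] by auto
  have "\<exists>y\<in>F. x - y \<in> H" if "x \<in> M" for x
  proof -
    have "c x \<in> c ` F" using F(3) that by blast
    then obtain y where y: "y \<in> F" "c x = c y" by blast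
    have "x \<in> c x"
      unfolding c_def using int_module.subspace_0[OF H] by (rule rev_image_eqI) simp
    then obtain h where "h \<in> H" "x = y + h"
      using y(2) by (auto simp: c_def)
    then have "x - y \<in> H" by simp
    then show ?thesis using y(1) by (rule bexI)
  qed
  then show ?thesis using F(2) that[of F] by blast
qed

text \<open>With \<open>finite_index_inE\<close> this trades cosets for a finite set of
  representatives, the form used in all later index arguments. The representatives may lie outside
  \<open>M\<close>, so sums and images of them need no membership check.\<close>

lemma finite_index_inI:
  fixes H :: "'a::real_vector set"
  assumes H: "int_module.subspace H" and F: "finite F" "\<And>x. x \<in> M \<Longrightarrow> \<exists>y\<in>F. x - y \<in> H"
  shows "finite_index_in H M"
proof -
  define c where "c x = (+) x ` H" for x
  have sub: "c x \<subseteq> c y" if "x - y \<in> H" for x y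
  proof
    fix z assume "z \<in> c x"
    then obtain h where h: "h \<in> H" "z = x + h" unfolding c_def by (rule imageE)
    then have "z = y + ((x - y) + h)" by simp
    then show "z \<in> c y"
      unfolding c_def using int_module.subspace_add[OF H that h(1)] by (rule image_eqI)
  qed
  have "c x = c y" if "x - y \<in> H" for x y
    using sub that int_module.subspace_neg[OF H that] by (simp add: subset_antisym)
  then have "c ` M \<subseteq> c ` F"
    using F(2) by blast
  then have "finite (c ` M)"
    using F(1) finite_subset by blast
  then show ?thesis
    by (simp add: finite_index_in_def c_def)
qed

lemma finite_index_in_superset:
  fixes H K :: "'a::real_vector set"
  assumes H: "int_module.subspace H" and K: "int_module.subspace K"
    and HK: "H \<subseteq> K" and HM: "finite_index_in H M"
  shows "finite_index_in K M"
proof -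
  obtain F where "finite F" "\<forall>x\<in>M. \<exists>y\<in>F. x - y \<in> H"
    using finite_index_inE[OF H HM] by blast
  then show ?thesis
    using HK by (intro finite_index_inI[OF K, of F]) blast+
qed

text \<open>Tower argument: a representative modulo \<open>K\<close> plus a representative of the
  remainder modulo \<open>H\<close> represents the element modulo \<open>H\<close>.\<close>

lemma finite_index_in_trans:
  fixes H K :: "'a::real_vector set"
  assumes H: "int_module.subspace H" and K: "int_module.subspace K"
    and HK: "finite_index_in H K" and KM: "finite_index_in K M"
  shows "finite_index_in H M"
proof -
  obtain F where F: "finite F" "\<forall>x\<in>K. \<exists>y\<in>F. x - y \<in> H"
    using finite_index_inE[OF H HK] by blast
  obtain G where G: "finite G" "\<forall>x\<in>M. \<exists>y\<in>G. x - y \<in> K"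
    using finite_index_inE[OF K KM] by blast
  have "\<exists>y\<in>(\<lambda>(u, v). u + v) ` (G \<times> F). x - y \<in> H" if "x \<in> M" for x
  proof -
    obtain y where y: "y \<in> G" "x - y \<in> K" using G(2) \<open>x \<in> M\<close> by blast
    obtain z where z: "z \<in> F" "x - y - z \<in> H" using F(2) y(2) by blast
    then have "x - (y + z) \<in> H" by (simp add: diff_diff_eq)
    then show ?thesis using y(1) z(1) by force
  qed
  then show ?thesis
    using F(1) G(1) by (intro finite_index_inI[OF H, of "(\<lambda>(u, v). u + v) ` (G \<times> F)"]) auto
qed

lemma finite_index_in_Int:
  fixes H K :: "'a::real_vector set"
  assumes H: "int_module.subspace H" and K: "int_module.subspace K"
    and HM: "finite_index_in H M"
  shows "finite_index_in (H \<inter> K) (M \<inter> K)"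
proof -
  obtain F where F: "finite F" "\<forall>x\<in>M. \<exists>y\<in>F. x - y \<in> H"
    using finite_index_inE[OF H HM] by blast
  \<comment> \<open>The points of \<open>F\<close> need not lie in \<open>K\<close>, so each is
    moved within its coset of \<open>H\<close> to a point of \<open>M \<inter> K\<close>. If the
    coset contains no such point, the value of \<open>r\<close> is arbitrary but harmless.\<close>
  define r where "r y = (SOME x. x \<in> M \<inter> K \<and> x - y \<in> H)" for y
  have "\<exists>y\<in>r ` F. x - y \<in> H \<inter> K" if x: "x \<in> M \<inter> K" for x
  proof -
    obtain y where y: "y \<in> F" "x - y \<in> H" using F(2) x by blast
    have r: "r y \<in> M \<inter> K \<and> r y - y \<in> H"
      unfolding r_def by (rule someI[of _ x]) (use x y(2) in blast)
    have "x - r y = (x - y) - (r y - y)" by simp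
    then have "x - r y \<in> H"
      using int_module.subspace_diff[OF H y(2)] r by metis
    moreover have "x - r y \<in> K"
      using int_module.subspace_diff[OF K] x r by blast
    ultimately show ?thesis using y(1) by blast
  qed
  then show ?thesis
    using F(1) by (intro finite_index_inI[OF int_module.subspace_inter[OF H K], of "r ` F"]) auto
qed

lemma commensurate_sym: "commensurate M N \<Longrightarrow> commensurate N M"
  by (simp add: commensurate_def Int_commute)

lemma commensurate_trans:
  fixes L M N :: "'a::real_vector set"
  assumes L: "int_module.subspace L" and M: "int_module.subspace M" and N: "int_module.subspace N"
    and LM: "commensurate L M" and MN: "commensurate M N"
  shows "commensurate L N"
proof -
  \<comment> \<open>Half of the claim, used for \<open>L, M, N\<close> and for
    \<open>N, M, L\<close>. The triple intersection has finite index in \<open>A \<inter> B\<close>,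
    hence in \<open>A\<close>, and it is contained in \<open>A \<inter> C\<close>.\<close>
  have *: "finite_index_in (A \<inter> C) A"
    if s: "int_module.subspace A" "int_module.subspace B" "int_module.subspace C"
      and f: "finite_index_in (A \<inter> B) A" "finite_index_in (B \<inter> C) B"
    for A B C :: "'a set"
  proof -
    note sub = int_module.subspace_inter
    have "finite_index_in (B \<inter> C \<inter> A) (B \<inter> A)"
      using finite_index_in_Int[OF sub[OF s(2,3)] s(1) f(2)] .
    then have "finite_index_in (B \<inter> C \<inter> A) A"
      using finite_index_in_trans[OF sub[OF sub[OF s(2,3)] s(1)] sub[OF s(2,1)]] f(1)
      by (simp add: Int_commute)
    then show ?thesis
      by (rule finite_index_in_superset[OF sub[OF sub[OF s(2,3)] s(1)] sub[OF s(1,3)], rotated]) blast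
  qed
  show ?thesis
    using *[OF L M N] *[OF N M L] LM MN by (simp add: commensurate_def Int_commute)
qed

lemma subspace_image_linear:
  fixes f :: "'a::real_vector \<Rightarrow> 'b::real_vector"
  assumes f: "linear f" and M: "int_module.subspace M"
  shows "int_module.subspace (f ` M)"
proof (rule int_module.subspaceI)
  show "0 \<in> f ` M"
    using linear_0[OF f] int_module.subspace_0[OF M] by force
  show "x + y \<in> f ` M" if "x \<in> f ` M" "y \<in> f ` M" for x y
    using that int_module.subspace_add[OF M] linear_add[OF f] by (smt (verit) imageE imageI)
  show "real_of_int c *\<^sub>R x \<in> f ` M" if "x \<in> f ` M" for c x
    using that int_module.subspace_scale[OF M] linear_scale[OF f] by (smt (verit) imageE imageI)
qed

text \<open>The image of a set of representatives represents the image, because \<open>f\<close>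
  sends \<open>M \<inter> N\<close> into the intersection of the images.\<close>

lemma commensurate_image:
  fixes f :: "'a::real_vector \<Rightarrow> 'b::real_vector"
  assumes f: "linear f" and M: "int_module.subspace M" and N: "int_module.subspace N"
    and MN: "commensurate M N"
  shows "commensurate (f ` M) (f ` N)"
proof -
  note sub = int_module.subspace_inter
  have *: "finite_index_in (f ` M \<inter> f ` N) (f ` A)" if A: "finite_index_in (M \<inter> N) A" for A
  proof -
    obtain F where F: "finite F" "\<forall>x\<in>A. \<exists>y\<in>F. x - y \<in> M \<inter> N"
      using finite_index_inE[OF sub[OF M N] A] by blast
    have "\<exists>y\<in>f ` F. x - y \<in> f ` M \<inter> f ` N" if x: "x \<in> f ` A" for x
    proof -
      obtain a where a: "a \<in> A" "x = f a" using x by (rule imageE) blast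
      obtain y where y: "y \<in> F" "a - y \<in> M \<inter> N" using F(2) a(1) by blast
      have "f a - f y = f (a - y)" using linear_diff[OF f] by metis
      then show ?thesis using a y by auto
    qed
    then show ?thesis
      using F(1) by (intro finite_index_inI[OF sub[OF subspace_image_linear[OF f M]
            subspace_image_linear[OF f N]], of "f ` F"]) auto
  qed
  show ?thesis using * MN by (simp add: commensurate_def)
qed

section \<open>Injective endomorphisms of finitely generated free modules\<close>

lemma rat_span_clear_denominator:
  fixes B :: "'a::real_vector set"
  assumes "v \<in> rat_space.span B"
  shows "\<exists>n>0. real_of_int n *\<^sub>R v \<in> int_span B"
  using assms
proof (induction rule: rat_space.span_induct_alt)
  case base
  show ?case by (intro exI[of _ 1]) (simp add: int_module.span_zero)
next
  case (step c x y)
  obtain n where n: "n > 0" "real_of_int n *\<^sub>R y \<in> int_span B" using step by blast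
  obtain p q where pq: "quotient_of c = (p, q)" by fastforce
  then have q: "q > 0" and c: "(of_rat c :: real) = real_of_int p / real_of_int q"
    using quotient_of_denom_pos quotient_of_div[OF pq] by (auto simp: of_rat_divide)
  have "real_of_int (n * q) *\<^sub>R (of_rat c *\<^sub>R x + y)
      = real_of_int (n * p) *\<^sub>R x + real_of_int q *\<^sub>R (real_of_int n *\<^sub>R y)"
    using q by (simp add: c scaleR_right_distrib mult.commute)
  also have "\<dots> \<in> int_span B"
    by (intro int_module.span_add int_module.span_scale n(2) int_module.span_base[OF step(1)])
  finally show ?case using n(1) q by (intro exI[of _ "n * q"]) simp
qed

text \<open>Dimension count over the rationals: the images of the elements of \<open>B\<close> are
  independent, lie in the rational span of \<open>B\<close> and are as many as \<open>B\<close>, so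
  they span it.\<close>

lemma rat_span_image_eq:
  fixes f :: "'a::real_vector \<Rightarrow> 'a"
  assumes f: "linear f" "inj f" and B: "finite B" "\<not> rat_dependent B"
    and fB: "f ` B \<subseteq> rat_space.span B"
  shows "rat_space.span B \<subseteq> f ` rat_space.span B"
proof -
  interpret vs: vector_space_pair "\<lambda>(q::rat) (v::'a). (of_rat q :: real) *\<^sub>R v"
    "\<lambda>(q::rat) (v::'a). (of_rat q :: real) *\<^sub>R v" ..
  have lin: "Vector_Spaces.linear (\<lambda>(q::rat) (v::'a). (of_rat q :: real) *\<^sub>R v)
    (\<lambda>(q::rat) (v::'a). (of_rat q :: real) *\<^sub>R v) f"
    by unfold_locales (simp_all add: linear_add[OF f(1)] linear_scale[OF f(1)])
  have ind: "\<not> rat_dependent (f ` B)"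
    using vs.linear_independent_injective_image[OF lin B(2)[unfolded rat_dependent_def]] f(2)
    by (simp add: rat_dependent_def inj_on_def)
  have "card (f ` B) = card B"
    using f(2) by (simp add: card_image inj_on_def)
  \<comment> \<open>Otherwise adjoining \<open>b\<close> would give \<open>card B + 1\<close>
    independent vectors in the span of \<open>card B\<close> vectors.\<close>
  have "b \<in> rat_space.span (f ` B)" if b: "b \<in> B" for b
  proof (rule ccontr)
    assume nb: "b \<notin> rat_space.span (f ` B)"
    then have "\<not> rat_dependent (insert b (f ` B))"
      using ind by (rule rat_space.independent_insertI)
    then have "card (insert b (f ` B)) \<le> card B"
      using rat_space.independent_span_bound[OF B(1)] fB rat_space.span_base[OF b] by simp
    moreover have "b \<notin> f ` B"
      using nb rat_space.span_base by metis
    ultimately show False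
      using \<open>card (f ` B) = card B\<close> B(1) by simp
  qed
  then have "rat_space.span B \<subseteq> rat_space.span (f ` B)"
    by (intro rat_space.span_minimal rat_space.subspace_span subsetI)
  then show ?thesis
    by (simp add: vs.linear_span_image[OF lin])
qed

text \<open>Reducing the coefficients of an integral combination modulo \<open>N\<close> changes it
  by an element of \<open>H\<close>. Combinations with coefficients from 0 to \<open>N - 1\<close>
  therefore represent all cosets.\<close>

lemma finite_index_in_multiple:
  fixes H :: "'a::real_vector set"
  assumes H: "int_module.subspace H" and B: "finite B" and N: "N > 0"
    and NB: "\<And>b. b \<in> B \<Longrightarrow> real_of_int N *\<^sub>R b \<in> H"
  shows "finite_index_in H (int_span B)"
proof -
  let ?F = "(\<lambda>u. \<Sum>b\<in>B. real_of_int (u b) *\<^sub>R b) ` (B \<rightarrow>\<^sub>E {0..<N})"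
  have "\<exists>y\<in>?F. x - y \<in> H" if x: "x \<in> int_span B" for x
  proof -
    obtain u where u: "x = (\<Sum>b\<in>B. real_of_int (u b) *\<^sub>R b)"
      using x unfolding int_module.span_finite[OF B] by (rule imageE) blast
    define w where "w = restrict (\<lambda>b. u b mod N) B"
    have w: "w \<in> B \<rightarrow>\<^sub>E {0..<N}" using N by (auto simp: w_def)
    have "x - (\<Sum>b\<in>B. real_of_int (w b) *\<^sub>R b)
        = (\<Sum>b\<in>B. real_of_int (u b) *\<^sub>R b - real_of_int (w b) *\<^sub>R b)"
      by (simp add: u sum_subtractf)
    also have "\<dots> = (\<Sum>b\<in>B. real_of_int (u b div N) *\<^sub>R (real_of_int N *\<^sub>R b))"
    proof (rule sum.cong)
      fix b assume "b \<in> B"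
      have "u b - u b mod N = u b div N * N"
        by (simp add: minus_mod_eq_div_mult)
      then have "real_of_int (u b) - real_of_int (u b mod N) = real_of_int (u b div N) * real_of_int N"
        by (metis of_int_diff of_int_mult)
      then show "real_of_int (u b) *\<^sub>R b - real_of_int (w b) *\<^sub>R b
          = real_of_int (u b div N) *\<^sub>R (real_of_int N *\<^sub>R b)"
        using \<open>b \<in> B\<close> by (simp add: w_def flip: scaleR_left_diff_distrib)
    qed simp
    also have "\<dots> \<in> H"
      by (intro int_module.subspace_sum[OF H] int_module.subspace_scale[OF H] NB)
    finally show ?thesis using w by blast
  qed
  moreover have "finite ?F" using B by (intro finite_imageI finite_PiE) auto
  ultimately show ?thesis by (intro finite_index_inI[OF H, of ?F]) auto
qed

lemma finite_index_in_image_endomorphism: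
  fixes f :: "'a::real_vector \<Rightarrow> 'a"
  assumes f: "linear f" "inj f" and B: "finite B" "\<not> rat_dependent B"
    and fB: "f ` int_span B \<subseteq> int_span B"
  shows "finite_index_in (f ` int_span B) (int_span B)"
proof -
  have H: "int_module.subspace (f ` int_span B)"
    using subspace_image_linear[OF f(1)] int_module.subspace_span by blast
  \<comment> \<open>Seen as an additive group containing \<open>B\<close>, the rational span
    contains the integral span by minimality.\<close>
  have "int_module.subspace (rat_space.span B)"
  proof (rule int_module.subspaceI)
    show "real_of_int c *\<^sub>R x \<in> rat_space.span B" if "x \<in> rat_space.span B" for c x
      using rat_space.span_scale[OF that, of "of_int c"] by simp
  qed (auto intro: rat_space.span_zero rat_space.span_add)
  then have int_rat: "int_span B \<subseteq> rat_space.span B"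
    by (intro int_module.span_minimal rat_space.span_superset)
  have surj: "rat_space.span B \<subseteq> f ` rat_space.span B"
    using fB int_rat int_module.span_superset[of B]
    by (intro rat_span_image_eq[OF f B]) blast
  have "\<exists>n>0. real_of_int n *\<^sub>R b \<in> f ` int_span B" if b: "b \<in> B" for b
  proof -
    obtain v where v: "v \<in> rat_space.span B" "b = f v"
      using surj rat_space.span_base[OF b] by blast
    obtain n where "n > 0" "real_of_int n *\<^sub>R v \<in> int_span B"
      using rat_span_clear_denominator[OF v(1)] by blast
    then show ?thesis
      using v(2) linear_scale[OF f(1)] by (metis imageI)
  qed
  then obtain n where n: "\<And>b. b \<in> B \<Longrightarrow> n b > 0"
      "\<And>b. b \<in> B \<Longrightarrow> real_of_int (n b) *\<^sub>R b \<in> f ` int_span B"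
    by metis
  show ?thesis
  proof (rule finite_index_in_multiple[OF H B(1)])
    \<comment> \<open>The multipliers \<open>n b\<close> vary with \<open>b\<close>; their product
      is a multiple of each and serves for all of \<open>B\<close> at once.\<close>
    show "prod n B > 0" using n(1) by (rule prod_pos)
    fix b assume b: "b \<in> B"
    have "prod n B = prod n (B - {b}) * n b"
      using prod.remove[OF B(1) b, of n] by (simp add: mult.commute)
    then have "real_of_int (prod n B) *\<^sub>R b
        = real_of_int (prod n (B - {b})) *\<^sub>R (real_of_int (n b) *\<^sub>R b)"
      by simp
    then show "real_of_int (prod n B) *\<^sub>R b \<in> f ` int_span B"
      using int_module.subspace_scale[OF H n(2)[OF b]] by metis
  qed
qed

section \<open>Scaling factors\<close>

lemma linear_scaled_matrix:
  fixes R :: "real ^ 'm ^ 'n"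
  shows "linear (\<lambda>x. \<alpha> *\<^sub>R (R *v x))"
  by (intro linear_compose_scale_right) simp

lemma scaled_image_scaled_image:
  "scaled_image a R (scaled_image b S M) = scaled_image (a * b) (R ** S) M"
  by (simp add: scaled_image_def image_image matrix_vector_mult_scaleR matrix_vector_mul_assoc)

lemma subspace_spanning_free_module:
  "spanning_free_module M \<Longrightarrow> int_module.subspace M"
  unfolding spanning_free_module_def using int_module.subspace_span by blast

lemma subspace_scaled_image:
  "int_module.subspace M \<Longrightarrow> int_module.subspace (scaled_image \<alpha> R M)"
  unfolding scaled_image_def using subspace_image_linear[OF linear_scaled_matrix] .

lemma commensurate_scaled_image:
  "\<lbrakk>int_module.subspace M; int_module.subspace N; commensurate M N\<rbrakk>
    \<Longrightarrow> commensurate (scaled_image \<alpha> R M) (scaled_image \<alpha> R N)"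
  unfolding scaled_image_def using commensurate_image[OF linear_scaled_matrix] .

lemma infinite_spanning_free_module:
  fixes M :: "(real ^ 'd) set"
  assumes "spanning_free_module M"
  shows "infinite M"
proof -
  obtain B :: "(real ^ 'd) set" where B: "span B = UNIV" "M = int_span B"
    using assms unfolding spanning_free_module_def by blast
  obtain b where b: "b \<in> B" "b \<noteq> 0"
  proof (rule ccontr)
    assume "\<not> thesis"
    then have "B \<subseteq> {0}" using that by blast
    \<comment> \<open>The index type is nonempty, so any axis vector shows that the span of the zero
      vector is not the whole space.\<close>
    then have "(axis undefined 1 :: real ^ 'd) = 0"
      using span_mono[of B "{0}"] B(1) by auto
    then show False by (simp add: axis_eq_0_iff)
  qed
  have "inj (\<lambda>n. real_of_int n *\<^sub>R b)" using b(2) by (simp add: inj_on_def)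
  then have "infinite (range (\<lambda>n. real_of_int n *\<^sub>R b))"
    using infinite_UNIV_int range_inj_infinite finite_imageD by blast
  moreover have "range (\<lambda>n. real_of_int n *\<^sub>R b) \<subseteq> M"
    using B(2) b(1) int_module.span_scale int_module.span_base by blast
  ultimately show ?thesis using finite_subset by blast
qed

text \<open>A factor 0 would give the trivial subgroup finite index in the infinite group
  \<open>M\<close>. Hence one may divide by scaling factors.\<close>

lemma zero_notin_scal:
  assumes M: "spanning_free_module M"
  shows "0 \<notin> scal M R"
proof
  assume "0 \<in> scal M R"
  moreover have "0 \<in> M"
    using subspace_spanning_free_module[OF M] by (rule int_module.subspace_0)
  then have "scaled_image 0 R M \<inter> M = {0}"
    by (auto simp: scaled_image_def)
  ultimately have "finite_index_in {0} M"
    by (simp add: scal_def commensurate_def)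
  then have "finite ((\<lambda>x. {x}) ` M)"
    by (simp add: finite_index_in_def)
  then have "finite M"
    by (rule finite_imageD) (simp add: inj_on_def)
  then show False using infinite_spanning_free_module[OF M] by blast
qed

text \<open>A factor witnessing membership in \<open>OS M\<close> already works: the scaled image
  lies in \<open>M\<close>, so it equals the intersection, and only its index in \<open>M\<close>
  has to be finite.\<close>

lemma scal_nonempty:
  fixes M :: "(real ^ 'd) set"
  assumes M: "spanning_free_module M" and R: "R \<in> OS M"
  shows "scal M R \<noteq> {}"
proof -
  obtain B where B: "finite B" "\<not> rat_dependent B" "M = int_span B"
    using M unfolding spanning_free_module_def by blast
  obtain \<alpha> where \<alpha>: "\<alpha> > 0" "scaled_image \<alpha> R M \<subseteq> M" and orth: "orthogonal_matrix R"
    using R unfolding OS_def by blast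
  have "inj ((*v) R)"
    using orth by (metis inj_matrix_vector_mult invertible_def orthogonal_matrix_def)
  then have "inj (\<lambda>x. \<alpha> *\<^sub>R (R *v x))"
    using \<alpha>(1) by (auto simp: inj_on_def)
  then have "finite_index_in (scaled_image \<alpha> R M) M"
    using finite_index_in_image_endomorphism[OF linear_scaled_matrix _ B(1,2)] \<alpha>(2)
    by (simp add: scaled_image_def B(3))
  moreover have "scaled_image \<alpha> R M \<inter> M = scaled_image \<alpha> R M"
    using \<alpha>(2) by blast
  moreover have "finite_index_in K K" if "int_module.subspace K" for K :: "(real ^ 'd) set"
    by (rule finite_index_inI[OF that, of "{0}"]) simp_all
  ultimately have "\<alpha> \<in> scal M R"
    using subspace_scaled_image[OF subspace_spanning_free_module[OF M]]
    by (simp add: scal_def commensurate_def)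
  then show ?thesis by blast
qed

text \<open>Applying \<open>aR\<close> to \<open>bSM ~ M\<close> gives \<open>abRSM ~ aRM\<close>,
  and \<open>aRM ~ M\<close>.\<close>

lemma scal_mult:
  assumes M: "int_module.subspace M" and a: "a \<in> scal M R" and b: "b \<in> scal M S"
  shows "a * b \<in> scal M (R ** S)"
proof -
  have "commensurate (scaled_image (a * b) (R ** S) M) (scaled_image a R M)"
    using commensurate_scaled_image[OF subspace_scaled_image[OF M] M, of b S a R] b
    by (simp add: scal_def scaled_image_scaled_image)
  then show ?thesis
    using a commensurate_trans[OF subspace_scaled_image[OF M] subspace_scaled_image[OF M] M]
    by (simp add: scal_def)
qed

text \<open>Applying \<open>(c/b)R\<close> to \<open>bSM ~ M\<close> gives
  \<open>cRSM ~ (c/b)RM\<close>, while \<open>cRSM ~ M\<close>.\<close>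

lemma scal_divide_right:
  assumes M: "int_module.subspace M" and c: "c \<in> scal M (R ** S)" and b: "b \<in> scal M S" "b \<noteq> 0"
  shows "c / b \<in> scal M R"
proof -
  have "commensurate (scaled_image c (R ** S) M) (scaled_image (c / b) R M)"
    using commensurate_scaled_image[OF subspace_scaled_image[OF M] M, of b S "c / b" R] b
    by (simp add: scal_def scaled_image_scaled_image)
  then show ?thesis
    using c commensurate_trans[OF subspace_scaled_image[OF M] subspace_scaled_image[OF M] M
        commensurate_sym]
    by (simp add: scal_def)
qed

lemma scal_divide_left:
  assumes M: "int_module.subspace M" and R: "orthogonal_matrix R"
    and a: "a \<in> scal M R" "a \<noteq> 0" and c: "c \<in> scal M R"
  shows "c / a \<in> scal M (mat 1)"
proof -
  have "commensurate (scaled_image c R M) (scaled_image a R M)"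
    using a(1) c commensurate_trans[OF subspace_scaled_image[OF M] M subspace_scaled_image[OF M]]
    unfolding scal_def by (blast intro: commensurate_sym)
  \<comment> \<open>Both \<open>cRM\<close> and \<open>aRM\<close> are carried along the inverse of
    \<open>aR\<close>, whose matrix part is \<open>transpose R\<close> by orthogonality; the second
    becomes \<open>M\<close> itself.\<close>
  then have "commensurate (scaled_image (inverse a * c) (transpose R ** R) M)
      (scaled_image (inverse a * a) (transpose R ** R) M)"
    using commensurate_scaled_image[OF subspace_scaled_image[OF M] subspace_scaled_image[OF M]]
    by (metis scaled_image_scaled_image)
  moreover have "scaled_image 1 (mat 1) M = M"
    by (simp add: scaled_image_def)
  ultimately show ?thesis
    using a(2) R by (simp add: scal_def orthogonal_matrix divide_inverse mult.commute)
qed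

theorem theorem14:
  fixes M :: "(real ^ 'd) set"
    and R S :: "real ^ 'd ^ 'd"
    and \<alpha> :: real
  assumes "spanning_free_module M"
    and "R \<in> OS M"
    and "S \<in> OS M"
    and "\<alpha> \<in> scal M R"
  shows "scal M R = {\<alpha> * \<beta> | \<beta>. \<beta> \<in> scal M (mat 1)} \<and>
         scal M (R ** S) = {a * b | a b. a \<in> scal M R \<and> b \<in> scal M S}"
proof (intro conjI equalityI subsetI)
  note M = subspace_spanning_free_module[OF assms(1)]
  have \<alpha>: "\<alpha> \<noteq> 0" using zero_notin_scal[OF assms(1)] assms(4) by metis
  have R: "orthogonal_matrix R" using assms(2) by (simp add: OS_def)
  show "c \<in> {\<alpha> * \<beta> | \<beta>. \<beta> \<in> scal M (mat 1)}" if "c \<in> scal M R" for c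
    using scal_divide_left[OF M R assms(4) \<alpha> that] \<alpha> by (intro CollectI exI[of _ "c / \<alpha>"]) simp
  show "c \<in> scal M R" if "c \<in> {\<alpha> * \<beta> | \<beta>. \<beta> \<in> scal M (mat 1)}" for c
    using scal_mult[OF M assms(4)] that by fastforce
  show "c \<in> {a * b | a b. a \<in> scal M R \<and> b \<in> scal M S}" if "c \<in> scal M (R ** S)" for c
  proof -
    \<comment> \<open>Any one scaling factor \<open>b\<close> of \<open>S\<close> allows the
      factorization of \<open>c\<close> as \<open>c / b\<close> times \<open>b\<close>.\<close>
    obtain b where b: "b \<in> scal M S" using scal_nonempty[OF assms(1,3)] by blast
    then have b0: "b \<noteq> 0" using zero_notin_scal[OF assms(1)] by metis
    then have "c = c / b * b" by simp
    then show ?thesis using scal_divide_right[OF M that b b0] b by blast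
  qed
  show "c \<in> scal M (R ** S)" if "c \<in> {a * b | a b. a \<in> scal M R \<and> b \<in> scal M S}" for c
    using scal_mult[OF M] that by blast
qed

end
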